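(* Let $\mathcal{F}$ be a finite family of convex sets in $\mathbb{R}^d$ such that the intersection of every $2d$ or fewer sets of $\mathcal{F}$ contains an axis-parallel box of diameter one. Then $\bigcap \mathcal{F}$ contains an axis-parallel box of diameter $d^{-1/2}$.
   Context: An axis-parallel box is a product of closed intervals $[a_1,b_1] \times \cdots \times [a_d,b_d]$; diameter is with respect to the Euclidean norm. *)

theory Defs
  imports "HOL-Analysis.Analysis"
begin

end

theory Submission
  imports Defs
begin

text \<open>
  A box $[a,b]$ in dimension $d$ is a point $(a,b)$ of a $2d$-dimensional space, and the boxes
  contained in a convex set form a convex set there. Normalise by the sum of the side lengths,
  which is linear in $(a,b)$, instead of by the diameter: a box of diameter one has side sum at
  least one, so it shrinks to a box of side sum exactly one. The boxes of side sum one lie on a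
  hyperplane, whose dimension is $2d - 1$, so Helly's theorem in that hyperplane needs
  only $2d$ sets. By Cauchy--Schwarz the resulting box has diameter at least $d^{-1/2}$.
\<close>

text \<open>Radon's argument, with the affine dimension of a set \<open>S\<close> containing all
  members of \<open>F\<close> in place of the ambient dimension. By induction, for each
  \<open>K\<close> in \<open>F\<close> some point \<open>X K\<close> lies in all the other members.
  More than \<open>k\<close> such points in \<open>S\<close> are affinely dependent, and a point
  common to the hulls of a Radon partition lies in every member.\<close>

lemma Helly_aff_dim:
  fixes F :: "'a::euclidean_space set set"
  assumes "finite F" and "\<And>K. K \<in> F \<Longrightarrow> convex K" and "\<And>K. K \<in> F \<Longrightarrow> K \<subseteq> S"
    and "k > 0" and "aff_dim S < int k"
    and "\<And>G. G \<subseteq> F \<Longrightarrow> card G \<le> k \<Longrightarrow> \<Inter>G \<noteq> {}"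
  shows "\<Inter>F \<noteq> {}"
  using assms(1-3,6)
proof (induction F rule: finite_psubset_induct)
  case (psubset F)
  show ?case
  proof (cases "card F \<le> k")
    case True
    then show ?thesis
      using psubset.prems(3) by blast
  next
    case False
    have "\<Inter>(F - {K}) \<noteq> {}" if "K \<in> F" for K
      by (rule psubset.IH) (use that psubset.prems in blast)+
    then have "\<forall>K\<in>F. \<exists>x. x \<in> \<Inter>(F - {K})"
      by blast
    then obtain X where X: "\<And>K. K \<in> F \<Longrightarrow> X K \<in> \<Inter>(F - {K})"
      by metis
    show ?thesis
    proof (cases "inj_on X F")
      case False
      \<comment> \<open>\<open>X K\<close> can miss only \<open>K\<close> and \<open>X L\<close> can
        miss only \<open>L\<close>, so a common value misses neither.\<close>
      then obtain K L where KL: "K \<in> F" "L \<in> F" "K \<noteq> L" "X K = X L"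
        unfolding inj_on_def by blast
      then have "X K \<in> \<Inter>F"
        using X[OF KL(1)] X[OF KL(2)] by auto
      then show ?thesis
        by blast
    next
      case inj: True
      have "X K \<in> S" if "K \<in> F" for K
      proof -
        \<comment> \<open>A second member \<open>L\<close> is needed: \<open>X K\<close> is known to
          lie only in members other than \<open>K\<close>, and it reaches \<open>S\<close> through
          \<open>L\<close>.\<close>
        have "F \<noteq> {K}"
          using \<open>\<not> card F \<le> k\<close> \<open>k > 0\<close> by auto
        then obtain L where "L \<in> F" "L \<noteq> K"
          using \<open>K \<in> F\<close> by blast
        then show ?thesis
          using X[OF that] psubset.prems(2) by blast
      qed
      then have "aff_dim (X ` F) \<le> aff_dim S"
        by (intro aff_dim_subset) blast
      moreover have "card (X ` F) > k"
        using False by (simp add: card_image[OF inj])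
      ultimately have "affine_dependent (X ` F)"
        using affine_independent_iff_card[of "X ` F"] assms(5) by linarith
      then obtain M P z where MP: "M \<inter> P = {}" "M \<union> P = X ` F"
        and z: "z \<in> convex hull M" "z \<in> convex hull P"
        using Radon_partition[of "X ` F"] psubset.hyps(1) by blast
      have hull: "convex hull Q \<subseteq> K" if "K \<in> F" "Q \<subseteq> X ` F" "X K \<notin> Q" for K Q
      proof (rule hull_minimal)
        show "Q \<subseteq> K"
        proof
          fix x assume "x \<in> Q"
          then obtain L where "L \<in> F" "x = X L" "L \<noteq> K"
            using \<open>Q \<subseteq> X ` F\<close> \<open>X K \<notin> Q\<close> by blast
          then show "x \<in> K"
            using X[of L] \<open>K \<in> F\<close> by blast
        qed
      qed (use that psubset.prems in auto)
      \<comment> \<open>\<open>M\<close> and \<open>P\<close> are disjoint, so at least one of them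
        avoids \<open>X K\<close>, and the hull of that one lies in \<open>K\<close>.\<close>
      have "z \<in> K" if "K \<in> F" for K
        using hull[OF that, of M] hull[OF that, of P] MP z by blast
      then show ?thesis
        by blast
    qed
  qed
qed

text \<open>The claim splits into coordinates: the point at fraction \<open>t\<close> of the
  combined interval is the combination of the points at the same fraction \<open>t\<close> of the
  two given intervals.\<close>

lemma convex_combination_cbox_subset:
  fixes a b c d :: "real ^ 'n"
  assumes "a \<le> b" "c \<le> d" "0 \<le> u" "0 \<le> v"
  shows "cbox (u *\<^sub>R a + v *\<^sub>R c) (u *\<^sub>R b + v *\<^sub>R d) \<subseteq>
    {u *\<^sub>R x + v *\<^sub>R y | x y. x \<in> cbox a b \<and> y \<in> cbox c d}"
proof
  fix z assume z: "z \<in> cbox (u *\<^sub>R a + v *\<^sub>R c) (u *\<^sub>R b + v *\<^sub>R d)"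
  have "\<exists>x y. a $ i \<le> x \<and> x \<le> b $ i \<and> c $ i \<le> y \<and> y \<le> d $ i \<and> z $ i = u * x + v * y" for i
  proof -
    define l where "l = u * a $ i + v * c $ i"
    define h where "h = u * b $ i + v * d $ i"
    have "l \<le> z $ i" "z $ i \<le> h"
      using z by (auto simp: mem_box_cart l_def h_def)
    then have "z $ i \<in> closed_segment l h"
      by (auto simp: closed_segment_eq_real_ivl)
    then obtain t where t: "0 \<le> t" "t \<le> 1" "z $ i = (1 - t) * l + t * h"
      by (auto simp: closed_segment_def)
    have le: "a $ i \<le> b $ i" "c $ i \<le> d $ i"
      using assms by (auto simp: less_eq_vec_def)
    have between: "p \<le> (1 - t) * p + t * q \<and> (1 - t) * p + t * q \<le> q" if "p \<le> q" for p q :: real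
      using t(1,2) that convex_bound_le[of p q q "1 - t" t] convex_bound_le[of "-p" "-p" "-q" "1 - t" t]
      by (auto simp: algebra_simps)
    show ?thesis
      using between[OF le(1)] between[OF le(2)]
      by (intro exI[of _ "(1 - t) * a $ i + t * b $ i"] exI[of _ "(1 - t) * c $ i + t * d $ i"])
        (auto simp: t(3) l_def h_def algebra_simps)
  qed
  then obtain x y where xy: "\<And>i. a $ i \<le> x i \<and> x i \<le> b $ i \<and> c $ i \<le> y i \<and> y i \<le> d $ i
      \<and> z $ i = u * x i + v * y i"
    by metis
  have "z = u *\<^sub>R (\<chi> i. x i) + v *\<^sub>R (\<chi> i. y i)"
    by (simp add: vec_eq_iff xy)
  moreover have "(\<chi> i. x i) \<in> cbox a b" "(\<chi> i. y i) \<in> cbox c d"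
    by (simp_all add: mem_box_cart xy)
  ultimately show "z \<in> {u *\<^sub>R x + v *\<^sub>R y | x y. x \<in> cbox a b \<and> y \<in> cbox c d}"
    by blast
qed

text \<open>A pair stands for the box with these lower and upper corners. The condition
  \<open>fst p \<le> snd p\<close> excludes empty boxes, which lie in every \<open>K\<close> and
  would destroy convexity.\<close>

lemma convex_boxes_in_convex:
  fixes K :: "(real ^ 'n) set"
  assumes "convex K"
  shows "convex {p. fst p \<le> snd p \<and> cbox (fst p) (snd p) \<subseteq> K}"
proof (rule convexI)
  fix p q :: "(real ^ 'n) \<times> (real ^ 'n)" and u v :: real
  assume p: "p \<in> {p. fst p \<le> snd p \<and> cbox (fst p) (snd p) \<subseteq> K}"
    and q: "q \<in> {p. fst p \<le> snd p \<and> cbox (fst p) (snd p) \<subseteq> K}"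
    and uv: "0 \<le> u" "0 \<le> v" "u + v = 1"
  have "cbox (u *\<^sub>R fst p + v *\<^sub>R fst q) (u *\<^sub>R snd p + v *\<^sub>R snd q) \<subseteq> K"
    using convex_combination_cbox_subset[of "fst p" "snd p" "fst q" "snd q" u v] p q uv
      convexD[OF assms _ _ uv] by blast
  moreover have "u *\<^sub>R fst p + v *\<^sub>R fst q \<le> u *\<^sub>R snd p + v *\<^sub>R snd q"
    using p q uv by (auto simp: less_eq_vec_def intro!: add_mono mult_left_mono)
  ultimately show "u *\<^sub>R p + v *\<^sub>R q \<in> {p. fst p \<le> snd p \<and> cbox (fst p) (snd p) \<subseteq> K}"
    by simp
qed

lemma diameter_cbox_cart:
  fixes a b :: "real ^ 'n"
  assumes "a \<le> b"
  shows "diameter (cbox a b) = norm (b - a)"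
  using assms diameter_cbox[of a b]
  by (auto simp: eucl_le[of a b] dist_norm norm_minus_commute)

lemma inner_one_cart: "(1 :: real ^ 'n) \<bullet> x = (\<Sum>i\<in>UNIV. x $ i)"
  by (simp add: inner_vec_def)

lemma norm_one_cart: "norm (1 :: real ^ 'n) = sqrt (real CARD('n))"
  by (simp add: norm_eq_sqrt_inner inner_one_cart)

text \<open>Scaling the side vector while fixing the lower corner multiplies both side sum and
  diameter by \<open>t\<close>; the main proof normalises first one and then the other in this
  way.\<close>

lemma shrink_cbox:
  fixes a b :: "real ^ 'n"
  assumes "a \<le> b" "0 \<le> t" "t \<le> 1"
  shows "a \<le> a + t *\<^sub>R (b - a)" "cbox a (a + t *\<^sub>R (b - a)) \<subseteq> cbox a b"
proof -
  have "t * (b $ i - a $ i) \<le> b $ i - a $ i" for i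
    using assms by (intro mult_left_le_one_le) (auto simp: less_eq_vec_def)
  then have "a + t *\<^sub>R (b - a) \<le> b"
    by (simp add: less_eq_vec_def algebra_simps)
  then show "cbox a (a + t *\<^sub>R (b - a)) \<subseteq> cbox a b"
    by (auto simp: interval_cbox_cart[symmetric])
  show "a \<le> a + t *\<^sub>R (b - a)"
    using assms by (simp add: less_eq_vec_def)
qed

theorem theorem3p8:
  fixes F :: "(real ^ 'n) set set"
  assumes "finite F"
    and "\<forall>K\<in>F. convex K"
    and "\<forall>G. G \<subseteq> F \<and> card G \<le> 2 * CARD('n) \<longrightarrow>
           (\<exists>a b. cbox a b \<subseteq> \<Inter>G \<and> diameter (cbox a b) = 1)"
  shows "\<exists>a b. cbox a b \<subseteq> \<Inter>F \<and> diameter (cbox a b) = real CARD('n) powr (-1/2)"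
proof -
  \<comment> \<open>Here \<open>1\<close> is the all-ones vector, so the inner product of
    \<open>(-1, 1)\<close> with \<open>(a, b)\<close> is the side sum of the box.\<close>
  define H :: "((real ^ 'n) \<times> (real ^ 'n)) set" where "H = {p. (-1, 1) \<bullet> p = 1}"
  define B :: "(real ^ 'n) set \<Rightarrow> ((real ^ 'n) \<times> (real ^ 'n)) set"
    where "B = (\<lambda>K. {p. fst p \<le> snd p \<and> cbox (fst p) (snd p) \<subseteq> K} \<inter> H)"
  have mem_H: "(a, b) \<in> H \<longleftrightarrow> 1 \<bullet> (b - a) = 1" for a b
    by (simp add: H_def inner_diff_right)
  have B_Inter: "B (\<Inter>G) \<subseteq> \<Inter>(B ` G)" for G
    by (auto simp: B_def)
  have small: "B (\<Inter>G) \<noteq> {}" if G: "G \<subseteq> F" "card G \<le> 2 * CARD('n)" for G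
  proof -
    obtain a b where ab: "cbox a b \<subseteq> \<Inter>G" "diameter (cbox a b) = 1"
      using assms(3) G by blast
    \<comment> \<open>The empty set has diameter 0, so diameter one forces correctly ordered
      corners.\<close>
    then have "cbox a b \<noteq> {}"
      by auto
    then have le: "a \<le> b"
      by (simp add: interval_cbox_cart[symmetric])
    define s where "s = 1 \<bullet> (b - a)"
    \<comment> \<open>The Euclidean norm is at most the l1 norm, so the side sum \<open>s\<close> is
      at least one and \<open>1 / s\<close> is an admissible shrinking factor.\<close>
    have "norm (b - a) \<le> (\<Sum>i\<in>UNIV. \<bar>(b - a) $ i\<bar>)"
      by (rule norm_le_l1_cart)
    also have "\<dots> = s"
      using le by (simp add: s_def inner_one_cart less_eq_vec_def)
    finally have "1 \<le> s"
      using ab(2) diameter_cbox_cart[OF le] by simp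
    then have t: "0 \<le> 1 / s" "1 / s \<le> 1" "s \<noteq> 0"
      by auto
    define c where "c = a + (1 / s) *\<^sub>R (b - a)"
    have "(a, c) \<in> H"
      using t(3) by (simp add: mem_H c_def s_def)
    then have "(a, c) \<in> B (\<Inter>G)"
      using ab(1) shrink_cbox[OF le t(1,2)] by (auto simp: B_def c_def)
    then show ?thesis
      by blast
  qed
  have "\<Inter>(B ` F) \<noteq> {}"
  proof (rule Helly_aff_dim)
    show "finite (B ` F)"
      using assms(1) by simp
    show "convex C" if "C \<in> B ` F" for C
      using that assms(2)
      by (auto simp: B_def H_def intro!: convex_Int convex_boxes_in_convex convex_hyperplane)
    show "C \<subseteq> H" if "C \<in> B ` F" for C
      using that by (auto simp: B_def)
    show "0 < 2 * CARD('n)"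
      by simp
    have "((-1, 1) :: (real ^ 'n) \<times> (real ^ 'n)) \<noteq> 0"
      by (simp add: zero_prod_def)
    then have "aff_dim H = int (2 * CARD('n) - 1)"
      unfolding H_def by (subst aff_dim_hyperplane) (auto simp: mult_2)
    then show "aff_dim H < int (2 * CARD('n))"
      by (simp add: of_nat_diff Suc_leI)
    show "\<Inter>C \<noteq> {}" if C: "C \<subseteq> B ` F" "card C \<le> 2 * CARD('n)" for C
    proof -
      \<comment> \<open>\<open>B\<close> may identify distinct sets; choosing one preimage for each
        member of \<open>C\<close> keeps the cardinality within the bound.\<close>
      obtain G where "G \<subseteq> F" "inj_on B G" "C = B ` G"
        using C(1) by (auto simp: subset_image_inj)
      then show ?thesis
        using small[of G] B_Inter[of G] C(2) by (auto simp: card_image)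
    qed
  qed
  have "B (\<Inter>F) \<noteq> {}"
  \<comment> \<open>For empty \<open>F\<close> the intersection of the image is the whole space of
    pairs and says nothing about \<open>H\<close>; the hypothesis for the empty subfamily supplies
    the box instead.\<close>
  proof (cases "F = {}")
    case True
    then show ?thesis
      using small[of F] by simp
  next
    case False
    then have "\<Inter>(B ` F) \<subseteq> B (\<Inter>F)"
      by (auto simp: B_def)
    then show ?thesis
      using \<open>\<Inter>(B ` F) \<noteq> {}\<close> by blast
  qed
  then obtain a b where ab: "a \<le> b" "1 \<bullet> (b - a) = 1" "cbox a b \<subseteq> \<Inter>F"
    by (auto simp: B_def mem_H)
  define r where "r = real CARD('n) powr (-1/2)"
  have r: "r = 1 / sqrt (real CARD('n))"
    by (simp add: r_def powr_minus_divide powr_half_sqrt)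
  \<comment> \<open>Cauchy-Schwarz against the all-ones vector, whose norm is the square root of the
    dimension.\<close>
  have "1 \<le> sqrt (real CARD('n)) * norm (b - a)"
    using norm_cauchy_schwarz[of 1 "b - a"] ab(2) by (simp add: norm_one_cart)
  then have "r \<le> norm (b - a)"
    by (simp add: r field_simps)
  moreover have "0 < r"
    by (simp add: r)
  ultimately have t: "0 \<le> r / norm (b - a)" "r / norm (b - a) \<le> 1" "norm (b - a) \<noteq> 0"
    by (auto simp: divide_le_eq_1)
  \<comment> \<open>The diameter is so far only at least \<open>r\<close>; a second shrinking makes
    it exactly \<open>r\<close>.\<close>
  define c where "c = a + (r / norm (b - a)) *\<^sub>R (b - a)"
  have "diameter (cbox a c) = r"
    using diameter_cbox_cart[OF shrink_cbox(1)[OF ab(1) t(1,2)]] t(3) \<open>0 < r\<close>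
    by (simp add: c_def)
  moreover have "cbox a c \<subseteq> \<Inter>F"
    using shrink_cbox(2)[OF ab(1) t(1,2)] ab(3) unfolding c_def by blast
  ultimately show ?thesis
    unfolding r_def by blast
qed

end
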